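(* Let $q$ be an odd prime power, let $S(i)=\{x\in\mathbb{F}_q : N(x-i)\in\square_q\}$ and $\mathcal{P}_L=S(i)\cup\{i,-i\}\subseteq\mathbb{F}_q[i]$. Then $\mathcal{P}_L$ is an integral point set. If moreover $q\neq 9$, then $\mathcal{P}_L$ is a maximal integral point set.
   Context: Let $\mathbb{F}_q$ be the field with $q$ elements, $q$ odd, and $\square_q$ the set of squares in $\mathbb{F}_q$ including $0$. The affine plane $\mathbb{F}_q^2$ is identified with the ring $\mathbb{F}_q[i]=\mathbb{F}_q[X]/(X^2+1)$, where $i$ is the class of $X$, via $(x,y)\leftrightarrow x+yi$; for $x,y\in\mathbb{F}_q$ put $N(x+yi)=x^2+y^2$. The line $\mathbb{F}_q\cdot 1\subseteq\mathbb{F}_q[i]$ is written $\mathbb{F}_q$. Points $z,w$ are at integral distance if $N(z-w)\in\square_q$; so $S(i)$ is the set of points of the line $\mathbb{F}_q$ at integral distance to $i$. A point set is integral if all pairs of its points are at integral distance; an integral point set is maximal if it is not properly contained in another integral point set in $\mathbb{F}_q^2$. *)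

theory Defs
  imports
    "HOL-Computational_Algebra.Computational_Algebra"
    "HOL-Library.Cardinality"
begin

(* The ring R[i] = R[X]/(X^2 + 1), where Gauss x y stands for x + y i. The ring is built on pairs
   of coordinates; the lemmas about gauss_of_poly below show that, over a field, it is the quotient
   of R[X] by the ideal (X^2 + 1), with ii the class of X. Note that -1 may be a square in R, so
   this need not be a field, and ii differs from any square root of -1 lying in R. *)

datatype 'a gauss = Gauss (x_coord: 'a) (y_coord: 'a)

instantiation gauss :: (comm_ring_1) comm_ring_1
begin

definition "0 = Gauss 0 0"
definition "1 = Gauss 1 0"
definition "z + w = Gauss (x_coord z + x_coord w) (y_coord z + y_coord w)"
definition "- z = Gauss (- x_coord z) (- y_coord z)"
definition "z - w = Gauss (x_coord z - x_coord w) (y_coord z - y_coord w)"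
definition "z * w = Gauss (x_coord z * x_coord w - y_coord z * y_coord w)
                          (x_coord z * y_coord w + y_coord z * x_coord w)"

instance
  by standard
     (auto simp: zero_gauss_def one_gauss_def plus_gauss_def uminus_gauss_def minus_gauss_def
        times_gauss_def algebra_simps)

end

definition ii :: "'a::comm_ring_1 gauss" where
  "ii = Gauss 0 1"

definition of_base :: "'a::comm_ring_1 \<Rightarrow> 'a gauss" where
  "of_base x = Gauss x 0"

definition gauss_of_poly :: "'a::field poly \<Rightarrow> 'a gauss" where
  "gauss_of_poly p = Gauss (coeff (p mod [:1, 0, 1:]) 0) (coeff (p mod [:1, 0, 1:]) 1)"

lemma Gauss_conv: "Gauss x y = of_base x + of_base y * ii"
  by (simp add: of_base_def ii_def plus_gauss_def times_gauss_def)

lemma mod_X2_plus_1_conv: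
  fixes p :: "'a::field poly"
  shows "p mod [:1, 0, 1:] = [:coeff (p mod [:1, 0, 1:]) 0, coeff (p mod [:1, 0, 1:]) 1:]"
proof (rule poly_eqI)
  fix n
  have "degree (p mod [:1, 0, 1:]) < 2"
    using degree_mod_less[of "[:1, 0, 1:]" p] by auto
  then have "coeff (p mod [:1, 0, 1:]) n = 0" if "n \<ge> 2"
    using that by (intro coeff_eq_0) auto
  then show "coeff (p mod [:1, 0, 1:]) n
      = coeff [:coeff (p mod [:1, 0, 1:]) 0, coeff (p mod [:1, 0, 1:]) 1:] n"
    by (auto simp: coeff_pCons split: nat.split)
qed

lemma gauss_of_poly_linear: "gauss_of_poly [:x, y:] = Gauss x y"
proof -
  have "[:x, y:] mod [:1, 0, 1:] = [:x, y:]"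
    by (rule mod_poly_less) (auto simp: degree_pCons_eq_if)
  then show ?thesis
    by (simp add: gauss_of_poly_def)
qed

lemma gauss_of_poly_X: "gauss_of_poly [:0, 1:] = ii"
  by (simp add: gauss_of_poly_linear ii_def)

lemma gauss_of_poly_const: "gauss_of_poly [:x:] = of_base x"
  using gauss_of_poly_linear[of x 0] by (simp add: of_base_def)

lemma gauss_of_poly_1: "gauss_of_poly 1 = 1"
  using gauss_of_poly_const[of 1] by (simp add: of_base_def one_gauss_def flip: one_pCons)

lemma gauss_of_poly_add: "gauss_of_poly (p + q) = gauss_of_poly p + gauss_of_poly q"
  by (simp add: gauss_of_poly_def plus_gauss_def poly_mod_add_left)

lemma gauss_of_poly_mult: "gauss_of_poly (p * q) = gauss_of_poly p * gauss_of_poly q"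
proof -
  define a b c d where abcd:
    "a = coeff (p mod [:1, 0, 1:]) 0" "b = coeff (p mod [:1, 0, 1:]) 1"
    "c = coeff (q mod [:1, 0, 1:]) 0" "d = coeff (q mod [:1, 0, 1:]) 1"
  have "p * q mod [:1, 0, 1:] = [:a, b:] * [:c, d:] mod [:1, 0, 1:]"
    unfolding abcd mod_X2_plus_1_conv[symmetric] by (simp add: mod_mult_eq)
  also have "[:a, b:] * [:c, d:] = [:a * c - b * d, a * d + b * c:] + [:b * d:] * [:1, 0, 1:]"
    by (simp add: algebra_simps)
  also have "\<dots> mod [:1, 0, 1:] = [:a * c - b * d, a * d + b * c:] mod [:1, 0, 1:]"
    by (rule mod_mult_self1)
  finally have "gauss_of_poly (p * q) = gauss_of_poly [:a * c - b * d, a * d + b * c:]"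
    by (simp add: gauss_of_poly_def)
  then show ?thesis
    by (simp add: gauss_of_poly_linear) (simp add: gauss_of_poly_def times_gauss_def abcd)
qed

lemma surj_gauss_of_poly: "surj gauss_of_poly"
proof (rule surjI)
  show "gauss_of_poly [:x_coord z, y_coord z:] = z" for z :: "'a gauss"
    by (simp add: gauss_of_poly_linear)
qed

lemma gauss_of_poly_eq_0_iff: "gauss_of_poly p = 0 \<longleftrightarrow> [:1, 0, 1:] dvd p"
proof -
  have "gauss_of_poly p = 0 \<longleftrightarrow> p mod [:1, 0, 1:] = 0"
    using mod_X2_plus_1_conv[of p] unfolding gauss_of_poly_def zero_gauss_def gauss.inject
    by (metis coeff_0 pCons_0_0)
  then show ?thesis
    by (simp add: dvd_eq_mod_eq_0)
qed

definition N :: "'a::comm_ring_1 gauss \<Rightarrow> 'a" where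
  "N z = (x_coord z)\<^sup>2 + (y_coord z)\<^sup>2"

(* is_square holds for 0 as well. *)
definition integral_distance :: "'a::comm_ring_1 gauss \<Rightarrow> 'a gauss \<Rightarrow> bool" where
  "integral_distance z w \<longleftrightarrow> is_square (N (z - w))"

definition integral_point_set :: "'a::comm_ring_1 gauss set \<Rightarrow> bool" where
  "integral_point_set P \<longleftrightarrow> (\<forall>z\<in>P. \<forall>w\<in>P. integral_distance z w)"

definition maximal_integral_point_set :: "'a::comm_ring_1 gauss set \<Rightarrow> bool" where
  "maximal_integral_point_set P \<longleftrightarrow>
     integral_point_set P \<and> \<not> (\<exists>Q. integral_point_set Q \<and> P \<subset> Q)"

definition S :: "'a::comm_ring_1 gauss \<Rightarrow> 'a gauss set" where
  "S z = {of_base x | x. integral_distance (of_base x) z}"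

definition P_L :: "'a::comm_ring_1 gauss set" where
  "P_L = S ii \<union> {ii, - ii}"

end

(* Let T be the set of x in F_q with x^2 + 1 a nonsquare, and let z = a + b i be at integral distance
   to all of P_L. For b = 0 the distance to i puts z into S(i). For b \<noteq> 0, the distances to S(i) say
   that the affine map x |-> a + b x sends T into T, hence onto T. As T is symmetric about 0, summing
   the elements of T gives a |T| = 0 in F_q. Since |T| \<noteq> 0 in F_q, it follows that a = 0 and b T = T,
   so b^(2k) = 1 whenever the power sum M_k of x^(2k) over T does not vanish.
   Put m = (q - 1) / 2. By Euler's criterion, 2 M_k = (m choose k) - (-1)^k #{x. x^2 = -1} in F_q for
   k < m. In particular 4 M_1 is -1 or 3, so b^2 = 1 unless q = 3, where b^2 = 1 is trivial, or the
   characteristic is 3 and -1 is a square. In the last case 9 divides q, and M_2 and M_5 do not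
   vanish, so b^4 = b^10 = 1 and again b^2 = 1; the condition 5 < m is what excludes q = 9. *)

theory Submission
  imports Defs
begin

lemma is_square_iff: "is_square (a :: 'a::comm_ring_1) \<longleftrightarrow> (\<exists>y. a = y\<^sup>2)"
  by (auto simp: is_nth_power_def)

section \<open>Power sums over a finite field and Euler's criterion\<close>

lemma finite_field_power_card_minus_1:
  fixes x :: "'a::{field,finite}"
  assumes "x \<noteq> 0"
  shows "x ^ (CARD('a) - 1) = 1"
proof -
  have "(\<Prod>y\<in>UNIV-{0}. x * y) = (\<Prod>y\<in>UNIV-{0::'a}. y)"
    by (rule prod.reindex_bij_witness[of _ "\<lambda>y. y / x" "\<lambda>y. x * y"]) (use assms in auto)
  moreover have "(\<Prod>y\<in>UNIV-{0}. x * y) = x ^ (CARD('a) - 1) * (\<Prod>y\<in>UNIV-{0::'a}. y)"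
    by (simp add: prod.distrib)
  moreover have "(\<Prod>y\<in>UNIV-{0::'a}. y) \<noteq> 0"
    by simp
  ultimately show ?thesis by simp
qed

text \<open>Translation by 1 permutes the field, so the sum of its elements absorbs q copies of
  1.\<close>

lemma of_nat_CARD_eq_0: "of_nat CARD('a::{field,finite}) = (0 :: 'a)"
proof -
  have "(\<Sum>x\<in>UNIV. x + 1) = (\<Sum>x\<in>UNIV. x :: 'a)"
    by (rule sum.reindex_bij_witness[of _ "\<lambda>x. x - 1" "\<lambda>x. x + 1"]) auto
  then show ?thesis by (simp add: sum.distrib)
qed

lemma card_roots_of_unity_le:
  assumes "n > 0"
  shows "card {x::'a::field. x ^ n = 1} \<le> n"
proof -
  have "coeff (monom (1::'a) n - 1) n \<noteq> 0"
    using assms by (simp add: coeff_eq_0)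
  then have "monom (1::'a) n - 1 \<noteq> 0"
    by (metis coeff_0)
  then have "card {x::'a. poly (monom 1 n - 1) x = 0} \<le> degree (monom (1::'a) n - 1)"
    by (rule card_poly_roots_bound)
  also have "\<dots> \<le> n"
    by (intro degree_diff_le) (auto simp: degree_monom_le)
  finally show ?thesis by (simp add: poly_monom)
qed

text \<open>For 0 < k < q - 1 the polynomial X^k - 1 has too few roots to contain all nonzero
  elements. Any c \<noteq> 0 with c^k \<noteq> 1 yields a substitution x -> c x that multiplies the
  sum by c^k, so the sum vanishes.\<close>

lemma sum_power_UNIV_eq_0:
  assumes "k < CARD('a::{field,finite}) - 1"
  shows "(\<Sum>x\<in>UNIV. x ^ k :: 'a) = 0"
proof (cases "k = 0")
  case True
  \<comment> \<open>Since 0 ^ 0 = 1, the sum is q copies of 1.\<close>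
  then show ?thesis by (simp add: of_nat_CARD_eq_0)
next
  case False
  have "card {x::'a. x ^ k = 1} < card (UNIV - {0::'a})"
    using card_roots_of_unity_le[of k, where 'a = 'a] False assms by simp
  then have "\<not> UNIV - {0::'a} \<subseteq> {x. x ^ k = 1}"
    using card_mono[of "{x::'a. x ^ k = 1}" "UNIV - {0}"] by force
  then obtain c :: 'a where c: "c \<noteq> 0" "c ^ k \<noteq> 1" by auto
  have "(\<Sum>x\<in>UNIV. (c * x) ^ k) = (\<Sum>x\<in>UNIV. x ^ k)"
    by (rule sum.reindex_bij_witness[of _ "\<lambda>y. y / c" "\<lambda>y. c * y"]) (use c in auto)
  then have "c ^ k * (\<Sum>x\<in>UNIV. x ^ k) = (\<Sum>x\<in>UNIV. x ^ k)"
    by (simp add: power_mult_distrib sum_distrib_left)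
  with c show ?thesis by simp
qed

text \<open>The range reaches up to 2 (q - 1) because the binomial expansion in
  \<open>twice_moment\<close> produces exponents beyond q - 1; these are reduced by q - 1.\<close>

lemma sum_power_UNIV:
  assumes "k < 2 * (CARD('a::{field,finite}) - 1)"
  shows "(\<Sum>x\<in>UNIV. x ^ k :: 'a) = (if k = CARD('a) - 1 then -1 else 0)"
proof -
  define n where "n = CARD('a) - 1"
  have fermat: "x ^ n = 1" if "x \<noteq> 0" for x :: 'a
    using that finite_field_power_card_minus_1 unfolding n_def by blast
  have small: "(\<Sum>x\<in>UNIV. x ^ l :: 'a) = 0" if "l < n" for l
    using that sum_power_UNIV_eq_0 unfolding n_def by blast
  have "n \<noteq> 0" using assms unfolding n_def by linarith
  consider "k < n" | "k = n" | "k > n" by linarith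
  then have "(\<Sum>x\<in>UNIV. x ^ k :: 'a) = (if k = n then -1 else 0)"
  proof cases
    case 1
    then show ?thesis by (simp add: small)
  next
    case 2
    have "x ^ n = (if x = 0 then 0 else 1)" for x :: 'a
      using fermat \<open>n \<noteq> 0\<close> by simp
    then have "(\<Sum>x\<in>UNIV. x ^ n :: 'a) = (\<Sum>x::'a\<in>UNIV. 1 - (if x = 0 then 1 else 0 :: 'a))"
      by (intro sum.cong) auto
    also have "\<dots> = of_nat CARD('a) - 1"
      by (subst sum_subtractf) simp
    finally show ?thesis using 2 by (simp add: of_nat_CARD_eq_0)
  next
    case 3
    have "x ^ k = x ^ (k - n)" for x :: 'a
    proof (cases "x = 0")
      case False
      have "x ^ k = x ^ n * x ^ (k - n)"
        using 3 by (metis power_add le_add_diff_inverse less_imp_le)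
      then show ?thesis using fermat[OF False] by simp
    qed (use 3 in \<open>simp add: power_0_left\<close>)
    then have "(\<Sum>x\<in>UNIV. x ^ k :: 'a) = (\<Sum>x\<in>UNIV. x ^ (k - n))"
      by (intro sum.cong) blast+
    also have "\<dots> = 0" using assms 3 by (intro small) (simp add: n_def)
    finally show ?thesis using 3 by simp
  qed
  then show ?thesis by (simp add: n_def)
qed

lemma odd_CARD_imp_two_neq_0:
  assumes "odd CARD('a::{field,finite})"
  shows "(2::'a) \<noteq> 0"
proof
  assume "(2::'a) = 0"
  obtain m where "CARD('a) = 2 * m + 1" using assms by (rule oddE)
  with of_nat_CARD_eq_0[where 'a = 'a] \<open>2 = 0\<close> show False by simp
qed

text \<open>Squaring is at most two-to-one, so there are at least m nonzero squares. All are roots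
  of X^m - 1, which has at most m roots, so they are exactly its roots. Any other nonzero x has x^m
  = -1 because (x^m)^2 = 1.\<close>

lemma Euler_criterion_finite_field:
  fixes x :: "'a::{field,finite}"
  assumes q: "CARD('a) = 2 * m + 1" and "x \<noteq> 0"
  shows "x ^ m = (if is_square x then 1 else -1)"
proof -
  let ?Q = "(\<lambda>y::'a. y\<^sup>2) ` (UNIV - {0})"
  have "m \<noteq> 0"
    using q card_mono[of "UNIV" "{0, 1 :: 'a}"] by auto
  have sq: "?Q \<subseteq> {x. x ^ m = 1}"
    using finite_field_power_card_minus_1[where 'a = 'a] q by (auto simp flip: power_mult)
  have "2 * m = card (UNIV - {0::'a})" using q by simp
  also have "UNIV - {0::'a} = (\<Union>s\<in>?Q. {y. y\<^sup>2 = s})" by auto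
  also have "card \<dots> \<le> (\<Sum>s\<in>?Q. card {y::'a. y\<^sup>2 = s})" by (rule card_UN_le) auto
  also have "\<dots> \<le> (\<Sum>s\<in>?Q. 2)"
  proof (rule sum_mono)
    fix s assume "s \<in> ?Q"
    then obtain y where "s = y\<^sup>2" by auto
    then have "{y. y\<^sup>2 = s} = {y, - y}" by (auto simp: power2_eq_iff)
    then show "card {y. y\<^sup>2 = s} \<le> 2" by (simp add: card_insert_if)
  qed
  finally have "m \<le> card ?Q" by simp
  with sq card_roots_of_unity_le[of m, where 'a = 'a] \<open>m \<noteq> 0\<close>
  have Q: "?Q = {x. x ^ m = 1}"
    using card_mono[OF _ sq] by (intro card_subset_eq[OF _ sq]) auto
  have "is_square x \<longleftrightarrow> x \<in> ?Q"
    using \<open>x \<noteq> 0\<close> by (auto simp: is_square_iff)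
  then have 1: "is_square x \<longleftrightarrow> x ^ m = 1" unfolding Q by simp
  have "(x ^ m)\<^sup>2 = 1"
    using finite_field_power_card_minus_1[OF \<open>x \<noteq> 0\<close>] q by (simp add: mult.commute flip: power_mult)
  then have "x ^ m = 1 \<or> x ^ m = -1" by (simp add: power2_eq_1_iff)
  moreover have "(1::'a) \<noteq> -1"
    using odd_CARD_imp_two_neq_0[where 'a = 'a] q by (auto simp: eq_neg_iff_add_eq_0)
  ultimately show ?thesis using 1 by auto
qed

section \<open>The set T of points of the line outside S(i), and its even power sums\<close>

definition nonsquare_abscissas :: "'a::comm_ring_1 set" where
  "nonsquare_abscissas = {x. \<not> is_square (x\<^sup>2 + 1)}"

text \<open>With y = x^2 + 1, the expression (y^m)^2 - y^m is twice the indicator of T, so the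
  moment splits into two sums over the whole field: \<open>A\<close> for y^m and \<open>B\<close>
  for its square.\<close>

lemma twice_moment:
  fixes m k :: nat
  assumes q: "CARD('a::{field,finite}) = 2 * m + 1" and "k < m"
  shows "2 * (\<Sum>x\<in>nonsquare_abscissas. x ^ (2 * k) :: 'a) =
    of_nat (m choose k) - (- 1) ^ k * of_nat (card {x::'a. x\<^sup>2 = -1})"
proof -
  have "m > 0" using \<open>k < m\<close> by simp
  \<comment> \<open>The value at y = 0 relies on m > 0, which gives 0^m = 0.\<close>
  have ind: "(y ^ m)\<^sup>2 - y ^ m = (if is_square y then 0 else 2)" for y :: 'a
    using Euler_criterion_finite_field[OF q, of y] \<open>m > 0\<close> by (cases "y = 0") (auto simp: is_square_iff power_0_left)
  have sq: "((x\<^sup>2 + 1) ^ m)\<^sup>2 = (if x\<^sup>2 = -1 then 0 else 1)" for x :: 'a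
    using finite_field_power_card_minus_1[of "x\<^sup>2 + 1"] q \<open>k < m\<close>
    by (auto simp: eq_neg_iff_add_eq_0 mult.commute simp flip: power_mult)
  have pow: "x ^ (2 * (k + l)) = x ^ (2 * k) * (x\<^sup>2) ^ l" for x :: 'a and l
    by (simp only: distrib_left power_add power_mult)
  have "(\<Sum>x::'a\<in>UNIV. x ^ (2 * k) * (x\<^sup>2 + 1) ^ m)
      = (\<Sum>x::'a\<in>UNIV. \<Sum>l\<le>m. of_nat (m choose l) * x ^ (2 * (k + l)))"
    unfolding binomial_ring sum_distrib_left pow by (simp add: mult_ac)
  also have "\<dots> = (\<Sum>l\<le>m. of_nat (m choose l) * (\<Sum>x::'a\<in>UNIV. x ^ (2 * (k + l))))"
    by (subst sum.swap) (simp add: sum_distrib_left)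
  \<comment> \<open>The exponent 2 (k + l) is below 4 m = 2 (q - 1), and it equals q - 1 = 2 m only
    for l = m - k.\<close>
  also have "\<dots> = (\<Sum>l\<le>m. if l = m - k then - of_nat (m choose l) else 0)"
    using q \<open>k < m\<close> by (intro sum.cong refl, subst sum_power_UNIV) auto
  also have "\<dots> = - of_nat (m choose k)"
    using \<open>k < m\<close> by (simp add: binomial_symmetric[of k m])
  finally have A: "(\<Sum>x::'a\<in>UNIV. x ^ (2 * k) * (x\<^sup>2 + 1) ^ m) = - of_nat (m choose k)" .
  \<comment> \<open>The factor y^(2m) is 1 except at the roots of -1, where x^(2k) = (-1)^k has to
    be removed.\<close>
  have "(\<Sum>x::'a\<in>UNIV. x ^ (2 * k) * ((x\<^sup>2 + 1) ^ m)\<^sup>2)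
      = (\<Sum>x::'a\<in>UNIV. x ^ (2 * k) - (if x\<^sup>2 = -1 then (- 1) ^ k else 0))"
    by (intro sum.cong) (auto simp: sq power_mult)
  also have "\<dots> = - (\<Sum>x::'a\<in>UNIV. if x\<^sup>2 = -1 then (- 1) ^ k else 0 :: 'a)"
    using sum_power_UNIV_eq_0[of "2 * k", where 'a = 'a] q \<open>k < m\<close> by (simp add: sum_subtractf)
  also have "(\<Sum>x::'a\<in>UNIV. if x\<^sup>2 = -1 then (- 1) ^ k else 0 :: 'a)
      = (- 1) ^ k * of_nat (card {x::'a. x\<^sup>2 = -1})"
    by (simp add: sum.If_cases mult.commute)
  finally have B: "(\<Sum>x::'a\<in>UNIV. x ^ (2 * k) * ((x\<^sup>2 + 1) ^ m)\<^sup>2)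
      = - ((- 1) ^ k * of_nat (card {x::'a. x\<^sup>2 = -1}))" .
  have "2 * (\<Sum>x\<in>nonsquare_abscissas. x ^ (2 * k) :: 'a)
      = (\<Sum>x\<in>nonsquare_abscissas. x ^ (2 * k) * (((x\<^sup>2 + 1) ^ m)\<^sup>2 - (x\<^sup>2 + 1) ^ m))"
    unfolding sum_distrib_left ind by (intro sum.cong) (auto simp: nonsquare_abscissas_def)
  also have "\<dots> = (\<Sum>x\<in>UNIV. x ^ (2 * k) * (((x\<^sup>2 + 1) ^ m)\<^sup>2 - (x\<^sup>2 + 1) ^ m))"
    unfolding ind by (intro sum.mono_neutral_left) (auto simp: nonsquare_abscissas_def)
  also have "\<dots> = of_nat (m choose k) - (- 1) ^ k * of_nat (card {x::'a. x\<^sup>2 = -1})"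
    by (simp add: right_diff_distrib sum_subtractf A B)
  finally show ?thesis .
qed

lemma card_sqrt_minus_1:
  assumes "(2::'a::field) \<noteq> 0"
  shows "card {x::'a. x\<^sup>2 = -1} = (if is_square (-1 :: 'a) then 2 else 0)"
proof (cases "is_square (-1 :: 'a)")
  case True
  then obtain j :: 'a where j: "-1 = j\<^sup>2" by (auto simp: is_square_iff)
  then have "{x. x\<^sup>2 = -1} = {j, - j}" by (auto simp: power2_eq_iff)
  moreover have "j \<noteq> - j"
    using assms j by (auto simp: eq_neg_iff_add_eq_0 simp flip: mult_2)
  ultimately show ?thesis using True by simp
next
  case False
  then have "{x::'a. x\<^sup>2 = -1} = {}" by (auto simp: is_square_iff) metis
  then show ?thesis using False by simp
qed

section \<open>Affine maps that preserve T\<close>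

lemma nonsquare_abscissas_affine_invariance:
  fixes a b :: "'a::{field,finite}"
  assumes q: "CARD('a) = 2 * m + 1" and "b \<noteq> 0"
    and sub: "\<And>x. is_square (x\<^sup>2 + 1) \<Longrightarrow> is_square ((x - a)\<^sup>2 + b\<^sup>2)"
  shows "a = 0" "(\<lambda>x. b * x) ` nonsquare_abscissas = nonsquare_abscissas"
proof -
  let ?T = "nonsquare_abscissas :: 'a set"
  have two: "(2::'a) \<noteq> 0" using odd_CARD_imp_two_neq_0[where 'a = 'a] q by simp
  have "(\<lambda>x. a + b * x) ` ?T \<subseteq> ?T"
  proof (intro image_subsetI)
    fix x assume x: "x \<in> ?T"
    \<comment> \<open>This is b^2 (x^2 + 1), a nonsquare times a nonzero square. The contrapositive
      of \<open>sub\<close> at a + b x then applies.\<close>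
    have "\<not> is_square ((b * x)\<^sup>2 + b\<^sup>2)"
    proof
      assume "is_square ((b * x)\<^sup>2 + b\<^sup>2)"
      then obtain y where y: "(b * x)\<^sup>2 + b\<^sup>2 = y\<^sup>2" by (auto simp: is_square_iff)
      have "x\<^sup>2 + 1 = ((b * x)\<^sup>2 + b\<^sup>2) / b\<^sup>2"
        using \<open>b \<noteq> 0\<close> by (simp add: field_simps)
      with y have "x\<^sup>2 + 1 = (y / b)\<^sup>2" by (simp add: power_divide)
      with x show False by (auto simp: nonsquare_abscissas_def is_square_iff)
    qed
    with sub[of "a + b * x"] show "a + b * x \<in> ?T"
      by (auto simp: nonsquare_abscissas_def)
  qed
  moreover have inj: "inj_on (\<lambda>x. a + b * x) ?T" using \<open>b \<noteq> 0\<close> by (auto intro: inj_onI)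
  ultimately have T: "(\<lambda>x. a + b * x) ` ?T = ?T" by (intro endo_inj_surj) auto
  have "(\<Sum>x\<in>?T. - x) = (\<Sum>x\<in>?T. x)"
    by (rule sum.reindex_bij_witness[of _ uminus uminus]) (auto simp: nonsquare_abscissas_def)
  then have "2 * (\<Sum>x\<in>?T. x) = 0" by (simp only: sum_negf mult_2 neg_eq_iff_add_eq_0)
  then have S0: "(\<Sum>x\<in>?T. x) = 0" using two by simp
  have "(\<Sum>x\<in>?T. x) = (\<Sum>x\<in>?T. a + b * x)"
    using sum.reindex[OF inj, of "\<lambda>x. x"] T by simp
  also have "\<dots> = of_nat (card ?T) * a + b * (\<Sum>x\<in>?T. x)"
    by (simp only: sum.distrib sum_constant sum_distrib_left)
  finally have "of_nat (card ?T) * a = 0"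
    using S0 by simp
  \<comment> \<open>The moment for k = 0 gives 2 |T| = 1 - r, where r is the number of roots of -1.
    As r is 0 or 2, this is 1 or -1.\<close>
  moreover have "of_nat (card ?T) \<noteq> (0::'a)"
  proof -
    have "m > 0" using q card_mono[of "UNIV" "{0, 1 :: 'a}"] by auto
    then have "2 * of_nat (card ?T) = 1 - (of_nat (card {x::'a. x\<^sup>2 = -1}) :: 'a)"
      using twice_moment[OF q, of 0] by simp
    then show ?thesis by (auto simp: card_sqrt_minus_1[OF two] split: if_splits)
  qed
  ultimately show "a = 0" by simp
  with T show "(\<lambda>x. b * x) ` ?T = ?T" by simp
qed

text \<open>Substituting b x for x permutes T and multiplies the moment by b^(2k). The quantity in
  \<open>nz\<close> is twice that moment.\<close>

lemma power_eq_1_of_moment_neq_0: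
  fixes b :: "'a::{field,finite}"
  assumes "CARD('a) = 2 * m + 1" "b \<noteq> 0" "k < m"
    and T: "(\<lambda>x. b * x) ` nonsquare_abscissas = (nonsquare_abscissas :: 'a set)"
    and nz: "of_nat (m choose k) - (- 1) ^ k * of_nat (card {x::'a. x\<^sup>2 = -1}) \<noteq> (0::'a)"
  shows "b ^ (2 * k) = 1"
proof -
  let ?T = "nonsquare_abscissas :: 'a set"
  have inj: "inj_on (\<lambda>x. b * x) ?T" using \<open>b \<noteq> 0\<close> by (auto intro: inj_onI)
  have "(\<Sum>x\<in>?T. x ^ (2 * k)) = (\<Sum>x\<in>?T. (b * x) ^ (2 * k))"
    using sum.reindex[OF inj, of "\<lambda>x. x ^ (2 * k)"] T by simp
  also have "\<dots> = b ^ (2 * k) * (\<Sum>x\<in>?T. x ^ (2 * k))"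
    by (simp only: power_mult_distrib sum_distrib_left)
  finally have "(\<Sum>x\<in>?T. x ^ (2 * k)) = b ^ (2 * k) * (\<Sum>x\<in>?T. x ^ (2 * k))" .
  moreover have "(\<Sum>x\<in>?T. x ^ (2 * k)) \<noteq> 0"
    using twice_moment[OF assms(1,3)] nz by auto
  ultimately show ?thesis by simp
qed

section \<open>Characteristic 3: the order of the field and binomial coefficients\<close>

lemma card_additive_subgroup_dvd_CARD:
  fixes H :: "'a::{ab_group_add,finite} set"
  assumes "0 \<in> H" and diff: "\<And>x y. x \<in> H \<Longrightarrow> y \<in> H \<Longrightarrow> x - y \<in> H"
  shows "card H dvd CARD('a)"
proof (rule equiv_imp_dvd_card)
  let ?r = "{(x, y). y - x \<in> H}"
  have neg: "- x \<in> H" if "x \<in> H" for x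
    using diff[OF \<open>0 \<in> H\<close> that] by simp
  show "equiv UNIV ?r"
  proof (rule equivI)
    show "refl ?r" using \<open>0 \<in> H\<close> by (auto intro: refl_onI)
    show "sym ?r"
    proof (rule symI, clarify)
      fix x y assume "y - x \<in> H"
      from neg[OF this] show "x - y \<in> H" by simp
    qed
    show "trans ?r"
    proof (rule transI, clarify)
      fix x y z assume "y - x \<in> H" "z - y \<in> H"
      from diff[OF this(2) neg[OF this(1)]] show "z - x \<in> H" by simp
    qed
  qed simp
  \<comment> \<open>Lagrange's argument: every class is a translate of H.\<close>
  fix X assume "X \<in> UNIV // ?r"
  then obtain x where "X = ?r `` {x}" by (auto elim: quotientE)
  also have "\<dots> = (\<lambda>h. x + h) ` H"
    by (auto intro: image_eqI[of _ _ "_ - x"])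
  finally show "card H dvd card X" by (simp add: card_image)
qed auto

text \<open>The prime field \<open>?K\<close> has only the squares 0 and 1, so j lies outside it.
  Hence 1 and j are independent over \<open>?K\<close> and span an additive subgroup of order
  9.\<close>

lemma nine_dvd_CARD:
  fixes j :: "'a::{field,finite}"
  assumes three: "(3::'a) = 0" and j: "j\<^sup>2 = -1"
  shows "9 dvd CARD('a)"
proof -
  let ?K = "{0, 1, -1 :: 'a}"
  let ?h = "\<lambda>(x, y). x + y * j"
  have "(2::'a) = -1" using three by (simp add: eq_neg_iff_add_eq_0)
  then have K2: "(1::'a) + 1 = -1" "(- 1::'a) - 1 = 1"
    by (simp_all add: algebra_simps)
  have ne: "(1::'a) \<noteq> -1"
  proof
    assume "(1::'a) = -1"
    then have "(2::'a) = 0" by (simp add: eq_neg_iff_add_eq_0)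
    with \<open>2 = -1\<close> show False by simp
  qed
  have K: "x - y \<in> ?K" if "x \<in> ?K" "y \<in> ?K" for x y
    using that K2 by auto
  have sq: "x\<^sup>2 = 1" if "x \<in> ?K" "x \<noteq> 0" for x
    using that by auto
  have "inj_on ?h (?K \<times> ?K)"
  proof (rule inj_onI)
    fix u v assume u: "u \<in> ?K \<times> ?K" and v: "v \<in> ?K \<times> ?K" and "?h u = ?h v"
    define d e where "d = fst u - fst v" and "e = snd v - snd u"
    have "d \<in> ?K" "e \<in> ?K" using u v K unfolding d_def e_def by (metis mem_Times_iff)+
    have "d = e * j"
      using \<open>?h u = ?h v\<close> by (simp add: d_def e_def case_prod_unfold algebra_simps)
    then have "d\<^sup>2 = - e\<^sup>2" using j by (simp add: power_mult_distrib)
    \<comment> \<open>If e were nonzero, then d^2 = -1 with d^2 equal to 0 or 1, which is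
      impossible.\<close>
    then have "e = 0"
      using sq[OF \<open>d \<in> ?K\<close>] sq[OF \<open>e \<in> ?K\<close>] ne by (cases "d = 0"; cases "e = 0") auto
    with \<open>d = e * j\<close> show "u = v" by (auto simp: d_def e_def prod_eq_iff)
  qed
  moreover have "card ?K = 3" using ne by (auto simp: card_insert_if)
  ultimately have "card (?h ` (?K \<times> ?K)) = 9"
    by (simp add: card_image card_cartesian_product del: insert_Times_insert)
  moreover have "card (?h ` (?K \<times> ?K)) dvd CARD('a)"
  proof (rule card_additive_subgroup_dvd_CARD)
    show "0 \<in> ?h ` (?K \<times> ?K)" by (rule image_eqI[of _ _ "(0, 0)"]) auto
    fix x y assume "x \<in> ?h ` (?K \<times> ?K)" "y \<in> ?h ` (?K \<times> ?K)"
    then obtain u v where uv: "x = ?h u" "u \<in> ?K \<times> ?K" "y = ?h v" "v \<in> ?K \<times> ?K"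
      by blast
    then have "x - y = ?h (fst u - fst v, snd u - snd v)"
      by (simp add: case_prod_unfold algebra_simps)
    moreover have "(fst u - fst v, snd u - snd v) \<in> ?K \<times> ?K"
      using uv K by (metis mem_Times_iff fst_conv snd_conv)
    ultimately show "x - y \<in> ?h ` (?K \<times> ?K)" by blast
  qed
  ultimately show ?thesis by simp
qed

text \<open>The absorption identity k (n choose k) = n (n - 1 choose k - 1) exposes the factor 9 t +
  3; the multipliers 2, 4 and 5 are prime to 3. The form 9 t + 4 is that of m = (q - 1) / 2 when 9
  divides q.\<close>

lemma three_dvd_choose_2_5:
  "3 dvd (9 * t + 4 :: nat) choose 2" "3 dvd (9 * t + 4 :: nat) choose 5"
proof -
  have "2 * ((9 * t + 4) choose 2) = 3 * ((9 * t + 4) * (3 * t + 1))"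
    using times_binomial_minus1_eq[of 2 "9 * t + 4"] by (simp add: algebra_simps)
  then have "3 dvd 2 * ((9 * t + 4) choose 2)" by (metis dvd_triv_left)
  then show "3 dvd (9 * t + 4) choose 2" by presburger
  have "5 * ((9 * t + 4) choose 5) = (9 * t + 4) * ((9 * t + 3) choose 4)"
    using times_binomial_minus1_eq[of 5 "9 * t + 4"] by (simp add: add.commute)
  moreover have "4 * ((9 * t + 3) choose 4) = (9 * t + 3) * ((9 * t + 2) choose 3)"
    using times_binomial_minus1_eq[of 4 "9 * t + 3"] by (simp add: add.commute)
  then have "4 * ((9 * t + 3) choose 4) = 3 * ((3 * t + 1) * ((9 * t + 2) choose 3))"
    by (simp add: algebra_simps)
  then have "3 dvd 4 * ((9 * t + 3) choose 4)" by (metis dvd_triv_left)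
  then have "3 dvd (9 * t + 3) choose 4" by presburger
  ultimately have "3 dvd 5 * ((9 * t + 4) choose 5)" by simp
  then show "3 dvd (9 * t + 4) choose 5" by presburger
qed

section \<open>Dilations that preserve T\<close>

lemma square_eq_1_of_dilation:
  fixes b :: "'a::{field,finite}"
  assumes q: "CARD('a) = 2 * m + 1" and "CARD('a) \<noteq> 9" "b \<noteq> 0"
    and T: "(\<lambda>x. b * x) ` nonsquare_abscissas = (nonsquare_abscissas :: 'a set)"
  shows "b\<^sup>2 = 1"
proof -
  note power_eq_1 = power_eq_1_of_moment_neq_0[OF q \<open>b \<noteq> 0\<close> _ T]
  have two: "(2::'a) \<noteq> 0" using odd_CARD_imp_two_neq_0[where 'a = 'a] q by simp
  have m: "m > 0" using q card_mono[of "UNIV" "{0, 1 :: 'a}"] by auto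
  have M: "2 * of_nat m = (-1 :: 'a)"
    using of_nat_CARD_eq_0[where 'a = 'a] q by (simp add: eq_neg_iff_add_eq_0 add.commute)
  consider "m = 1" | "m > 1" "\<not> (is_square (-1 :: 'a) \<and> (3::'a) = 0)"
    | "is_square (-1 :: 'a)" "(3::'a) = 0" using m by linarith
  then show ?thesis
  proof cases
    case 1
    then show ?thesis using finite_field_power_card_minus_1[OF \<open>b \<noteq> 0\<close>] q by simp
  next
    case 2
    let ?M = "of_nat (m choose 1) - (- 1) ^ 1 * of_nat (card {x::'a. x\<^sup>2 = -1}) :: 'a"
    \<comment> \<open>As 2 m = q - 1 = -1 in the field, the left side is -1 + 2 r with r equal to 0
      or 2.\<close>
    have "2 * ?M = (if is_square (-1::'a) then 3 else - 1)"
      by (simp add: card_sqrt_minus_1[OF two] distrib_left M)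
    moreover have "(if is_square (-1::'a) then 3 else - 1 :: 'a) \<noteq> 0" using 2 by auto
    ultimately have "?M \<noteq> 0" by (metis mult_zero_right)
    from power_eq_1[OF \<open>m > 1\<close> this] show ?thesis by simp
  next
    case 3
    have r: "card {x::'a. x\<^sup>2 = -1} = 2" using 3 by (simp add: card_sqrt_minus_1[OF two])
    have "9 dvd CARD('a)" using 3 nine_dvd_CARD by (metis is_square_iff)
    \<comment> \<open>From 9 | 2 m + 1 it follows that m is 4 modulo 9, and m = 4 is the excluded q
      = 9. So m is at least 13, which admits k = 5.\<close>
    with q \<open>CARD('a) \<noteq> 9\<close> have "9 dvd m - 4" "m > 4"
      by presburger+
    then obtain t where "m - 4 = 9 * t" by (auto elim: dvdE)
    with \<open>m > 4\<close> have t: "m = 9 * t + 4" "t > 0" by linarith+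
    have zero: "of_nat n = (0::'a)" if "3 dvd n" for n
      using that 3 by (auto elim!: dvdE)
    \<comment> \<open>Both binomial coefficients vanish modulo 3 and r = 2, so twice the moment is
      -2 for k = 2 and 2 for k = 5.\<close>
    have "b ^ (2 * 2) = 1"
      using t three_dvd_choose_2_5(1)[of t] two by (intro power_eq_1) (simp_all add: zero r)
    moreover have "b ^ (2 * 5) = 1"
      using t three_dvd_choose_2_5(2)[of t] two by (intro power_eq_1) (simp_all add: zero r)
    moreover have "b ^ (2 * 5) = b ^ (2 * 2) * b ^ (2 * 2) * b\<^sup>2"
      by (simp flip: power_add)
    ultimately show ?thesis by simp
  qed
qed

section \<open>Integrality and maximality of \<open>P_L\<close>\<close>

lemma integral_point_set_P_L: "integral_point_set (P_L :: 'a::comm_ring_1 gauss set)"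
proof -
  \<comment> \<open>Here 4 is the norm of i - (-i), and 0 that of a point minus itself.\<close>
  have "\<exists>y. y\<^sup>2 = (4 :: 'a)" "\<exists>y. y\<^sup>2 = (0 :: 'a)"
    by (rule exI[of _ 2] exI[of _ 0], simp)+
  then show ?thesis
    by (auto simp: integral_point_set_def P_L_def S_def integral_distance_def N_def of_base_def ii_def
        minus_gauss_def uminus_gauss_def power2_commute[of 0] is_square_iff)
qed

text \<open>Maximality in pointwise form: no point outside \<open>P_L\<close> can be added to
  it.\<close>

lemma integral_to_P_L_imp_mem:
  fixes z :: "'a::{field,finite} gauss"
  assumes "odd CARD('a)" "CARD('a) \<noteq> 9"
    and dist: "\<And>w. w \<in> P_L \<Longrightarrow> integral_distance w z"
  shows "z \<in> P_L"
proof -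
  obtain a b where z: "z = Gauss a b" by (cases z)
  obtain m where m: "CARD('a) = 2 * m + 1" using assms(1) by (rule oddE)
  show ?thesis
  proof (cases "b = 0")
    case True
    have "integral_distance ii z" using dist by (simp add: P_L_def)
    with True z have "integral_distance z ii"
      by (simp add: integral_distance_def N_def ii_def minus_gauss_def)
    with True z show ?thesis by (auto simp: P_L_def S_def of_base_def)
  next
    case False
    have "is_square ((x - a)\<^sup>2 + b\<^sup>2)" if "is_square (x\<^sup>2 + 1)" for x
    proof -
      have "of_base x \<in> P_L"
        using that by (auto simp: P_L_def S_def integral_distance_def N_def of_base_def ii_def minus_gauss_def)
      from dist[OF this] show ?thesis
        by (simp add: z integral_distance_def N_def of_base_def minus_gauss_def)
    qed
    note * = nonsquare_abscissas_affine_invariance[OF m False this]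
    have "b\<^sup>2 = 1" using square_eq_1_of_dilation[OF m assms(2) False *(2)] .
    then have "b = 1 \<or> b = -1" by (simp add: power2_eq_1_iff)
    with *(1) z show ?thesis by (auto simp: P_L_def ii_def uminus_gauss_def)
  qed
qed

theorem theorem10:
  assumes "odd CARD('a::{field,finite})"
  shows "integral_point_set (P_L :: 'a gauss set) \<and>
    (CARD('a) \<noteq> 9 \<longrightarrow> maximal_integral_point_set (P_L :: 'a gauss set))"
proof (intro conjI impI)
  show "integral_point_set (P_L :: 'a gauss set)" by (rule integral_point_set_P_L)
  assume "CARD('a) \<noteq> 9"
  have "Q \<subseteq> P_L" if "integral_point_set Q" "P_L \<subset> Q" for Q :: "'a gauss set"
  proof
    fix z assume "z \<in> Q"
    show "z \<in> P_L"
      by (rule integral_to_P_L_imp_mem[OF assms \<open>CARD('a) \<noteq> 9\<close>])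
        (use that \<open>z \<in> Q\<close> in \<open>auto simp: integral_point_set_def\<close>)
  qed
  then show "maximal_integral_point_set (P_L :: 'a gauss set)"
    using integral_point_set_P_L by (auto simp: maximal_integral_point_set_def)
qed

end
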